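(* Let $\kappa$ be a regular uncountable cardinal with $\kappa^{<\kappa}=\kappa$, and let $X\subseteq{}^\kappa\kappa$. The following are equivalent: (a) $X$ is not hereditarily $\kappa$-Baire; (b) there is $Q\subseteq X$ such that $Q$ is spherically closed in $X$, $|Q|=\kappa$, and $Q$ has no $\kappa$-isolated points (in its subspace topology).
   Context: ${}^\kappa\kappa$ has the topology generated by $N_s=\{x: s\subset x\}$, $s\in{}^{<\kappa}\kappa$, which is induced by the standard $\kappa$-ultrametric whose open balls are the sets $N_s$; the open balls of $X$ are the nonempty sets $N_s\cap X$. A subset $A\subseteq X$ is spherically closed in $X$ if whenever $(B_\alpha)$ is a decreasing sequence of open balls of $X$ such that each $B_\alpha$ meets $A$ and $\bigcap_\alpha B_\alpha\ne\emptyset$, then $\bigcap_\alpha B_\alpha\cap A\ne\emptyset$. A space is $\kappa$-Baire if the intersection of any $\kappa$ many dense open subsets is dense. $X$ is hereditarily $\kappa$-Baire if every spherically closed subset of $X$ is $\kappa$-Baire. A point $x$ of a space is $\kappa$-isolated if $\{x\}$ is an intersection of fewer than $\kappa$ open sets. *)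

theory Defs
  imports "HOL-Analysis.Analysis"
begin

unbundle cardinal_syntax

(* A cardinal \<kappa> is an initial ordinal. It is represented by a well-ordered type 'k whose
   order, as the relation below, is a cardinal order; the elements of 'k are the ordinals
   below \<kappa>, and the type 'k \<Rightarrow> 'k is the set of functions from \<kappa> to \<kappa>. *)
definition kappa :: "'k::wellorder rel" where
  "kappa = {(a, b). a \<le> b}"

(* Sequences of length less than \<kappa> are partial functions whose domain is an ordinal below \<kappa>. *)
definition short_seqs :: "('k::wellorder \<rightharpoonup> 'k) set" where
  "short_seqs = {s. \<exists>a. dom s = {..<a}}"

definition N :: "('k::wellorder \<rightharpoonup> 'k) \<Rightarrow> ('k \<Rightarrow> 'k) set" where
  "N s = {x. s \<subseteq>\<^sub>m Some \<circ> x}"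

definition kspace :: "('k::wellorder \<Rightarrow> 'k) topology" where
  "kspace = topology_generated_by (N ` short_seqs)"

definition open_balls :: "('k::wellorder \<Rightarrow> 'k) set \<Rightarrow> ('k \<Rightarrow> 'k) set set" where
  "open_balls X = {N s \<inter> X | s. s \<in> short_seqs \<and> N s \<inter> X \<noteq> {}}"

(* The sequence of balls is indexed by an arbitrary nonempty well-order r on a subset of 'k,
   i.e. by any nonzero ordinal below the successor cardinal of \<kappa>. This covers all transfinite
   lengths: every decreasing sequence of balls has at most \<kappa> many distinct terms, and deleting
   repetitions does not change the intersection. Length 0 is left out because the intersection
   of the empty family would be UNIV; for nonempty A that case imposes no condition. *)
definition spherically_closed ::
  "('k::wellorder \<Rightarrow> 'k) set \<Rightarrow> ('k \<Rightarrow> 'k) set \<Rightarrow> bool" where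
  "spherically_closed X A \<longleftrightarrow> A \<subseteq> X \<and>
     (\<forall>(r :: 'k rel) B. Well_order r \<longrightarrow> Field r \<noteq> {} \<longrightarrow>
        (\<forall>i\<in>Field r. B i \<in> open_balls X \<and> B i \<inter> A \<noteq> {}) \<longrightarrow>
        (\<forall>i j. (i, j) \<in> r \<longrightarrow> B j \<subseteq> B i) \<longrightarrow>
        (\<Inter>i\<in>Field r. B i) \<noteq> {} \<longrightarrow> (\<Inter>i\<in>Field r. B i) \<inter> A \<noteq> {})"

definition dense_in :: "'a topology \<Rightarrow> 'a set \<Rightarrow> bool" where
  "dense_in T D \<longleftrightarrow> D \<subseteq> topspace T \<and> T closure_of D = topspace T"

definition Baire_space :: "'k rel \<Rightarrow> 'a topology \<Rightarrow> bool" where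
  "Baire_space \<kappa> T \<longleftrightarrow>
     (\<forall>U :: 'k \<Rightarrow> 'a set. (\<forall>i\<in>Field \<kappa>. openin T (U i) \<and> dense_in T (U i)) \<longrightarrow>
        dense_in T (topspace T \<inter> (\<Inter>i\<in>Field \<kappa>. U i)))"

definition hereditarily_Baire :: "('k::wellorder \<Rightarrow> 'k) set \<Rightarrow> bool" where
  "hereditarily_Baire X \<longleftrightarrow>
     (\<forall>A. spherically_closed X A \<longrightarrow> Baire_space (kappa :: 'k rel) (subtopology kspace A))"

definition kappa_isolated :: "'k rel \<Rightarrow> 'a topology \<Rightarrow> 'a \<Rightarrow> bool" where
  "kappa_isolated \<kappa> T x \<longleftrightarrow>
     (\<exists>\<U>. |\<U>| <o \<kappa> \<and> (\<forall>U\<in>\<U>. openin T U) \<and> topspace T \<inter> \<Inter>\<U> = {x})"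

end

(* For regular \<kappa>, being \<kappa>-isolated means being isolated. If Q has size \<kappa> and no isolated points,
   the complements of its points are \<kappa> many dense open subsets of Q with empty intersection.

   Conversely, a spherically closed set that is not \<kappa>-Baire contains a spherically closed Y with
   open dense subsets U i (i < \<kappa>) whose intersection is empty. Let every y in Y follow a guide: the
   i-th guide of y is a point of U i chosen as a function of i and of the initial segment of y up to
   the least stage above all disagreements with earlier guides. The run of y dies at i if y leaves the
   i-th guide before reaching a ball contained in U i. A run that never dies and never coincides with
   a guide would put y into all U i; so each run stops, and Q consists of the y that agree with a
   guide while being alive. There are \<kappa> many guides because there are \<kappa> many short sequences; a
   point of Q is a limit of later guides; and if the run of x dies, the last guide of x lies in every
   ball around x that meets Q. *)

theory Submission
  imports Defs
begin

section \<open>Balls\<close>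

text \<open>This is the basic open set N_s for s the restriction of x to l. A ball is handled by a
  centre and a length instead of a partial function.\<close>

definition agree :: "'k::wellorder \<Rightarrow> ('k \<Rightarrow> 'a) \<Rightarrow> ('k \<Rightarrow> 'a) set" where
  "agree l x = {y. \<forall>a<l. y a = x a}"

text \<open>For distinct points this place measures their ultrametric distance: the later the place,
  the closer the points. On equal arguments the value is unspecified.\<close>

definition first_diff :: "('k::wellorder \<Rightarrow> 'a) \<Rightarrow> ('k \<Rightarrow> 'a) \<Rightarrow> 'k" where
  "first_diff x y = (LEAST a. x a \<noteq> y a)"

lemma agree_refl [simp]: "x \<in> agree l x"
  by (simp add: agree_def)

lemma agree_eq: "y \<in> agree l x \<Longrightarrow> agree l y = agree l x"
  by (auto simp: agree_def)

lemma agree_mono: "l \<le> m \<Longrightarrow> agree m x \<subseteq> agree l x"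
  by (auto simp: agree_def)

lemma agree_eq_mono: "y \<in> agree m x \<Longrightarrow> l \<le> m \<Longrightarrow> agree l y = agree l x"
  using agree_eq agree_mono by blast

lemma first_diff_neq: "x \<noteq> y \<Longrightarrow> x (first_diff x y) \<noteq> y (first_diff x y)"
  unfolding first_diff_def by (rule LeastI_ex) auto

lemma agree_first_diff: "y \<in> agree (first_diff x y) x"
  unfolding agree_def first_diff_def using not_less_Least by fastforce

lemma first_diff_ge: "x \<noteq> y \<Longrightarrow> y \<in> agree l x \<Longrightarrow> l \<le> first_diff x y"
  using first_diff_neq unfolding agree_def by (metis (mono_tags, lifting) linorder_not_le mem_Collect_eq)

text \<open>The isosceles principle: moving x by less than its distance to q does not change that
  distance.\<close>

lemma first_diff_agree:
  assumes "x \<noteq> q" "first_diff x q < l" "z \<in> agree l x"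
  shows "first_diff z q = first_diff x q" "z \<noteq> q"
proof -
  let ?d = "first_diff x q"
  have "z ?d \<noteq> q ?d"
    using assms first_diff_neq[of x q] by (auto simp: agree_def)
  moreover have "z a = q a" if "a < ?d" for a
    using that assms agree_first_diff[of q x] by (auto simp: agree_def)
  ultimately show "first_diff z q = ?d"
    unfolding first_diff_def[of z q] by (metis (mono_tags, lifting) Least_equality linorder_not_le)
  show "z \<noteq> q"
    using \<open>z ?d \<noteq> q ?d\<close> by auto
qed

lemma agree_eq_N: "agree l x = N (\<lambda>a. if a < l then Some (x a) else None)"
  by (force simp: agree_def N_def map_le_def dom_def split: if_splits)

lemma agree_in_N: "agree l x \<in> N ` short_seqs"
proof -
  have "(\<lambda>a. if a < l then Some (x a) else None) \<in> short_seqs"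
    by (auto simp: short_seqs_def dom_def split: if_splits)
  then show ?thesis
    unfolding agree_eq_N by blast
qed

text \<open>Every point of an ultrametric ball is a centre of it; one length l serves all
  centres.\<close>

lemma N_eq_agree:
  assumes "s \<in> short_seqs"
  obtains l where "\<And>x. x \<in> N s \<Longrightarrow> N s = agree l x"
proof -
  obtain l where l: "dom s = {..<l}"
    using assms by (auto simp: short_seqs_def)
  have "N s = agree l x" if "x \<in> N s" for x
    using that l by (auto simp: N_def agree_def map_le_def)
  then show ?thesis
    using that by blast
qed

section \<open>Open and dense sets in terms of balls\<close>

lemma openin_kspace: "openin kspace S \<longleftrightarrow> (\<forall>x\<in>S. \<exists>l. agree l x \<subseteq> S)"
proof
  assume "openin kspace S"
  then have "generate_topology_on (N ` short_seqs) S"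
    by (simp add: kspace_def openin_topology_generated_by_iff)
  then show "\<forall>x\<in>S. \<exists>l. agree l x \<subseteq> S"
  proof induction
    case (Int a b)
    show ?case
    proof
      fix x assume "x \<in> a \<inter> b"
      with Int obtain l m where "agree l x \<subseteq> a" "agree m x \<subseteq> b"
        by blast
      then have "agree (max l m) x \<subseteq> a \<inter> b"
        using agree_mono[of l "max l m" x] agree_mono[of m "max l m" x] by auto
      then show "\<exists>l. agree l x \<subseteq> a \<inter> b" ..
    qed
  next
    case (UN K)
    then show ?case by (meson Sup_upper UnionE order_trans)
  next
    case (Basis s)
    then show ?case using N_eq_agree by (metis imageE order_refl)
  qed auto
next
  assume S: "\<forall>x\<in>S. \<exists>l. agree l x \<subseteq> S"
  have "openin kspace (agree l x)" for l and x :: "'a \<Rightarrow> 'a"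
    unfolding kspace_def by (rule topology_generated_by_Basis[OF agree_in_N])
  then show "openin kspace S"
    using S openin_subopen[of kspace S] agree_refl by metis
qed

lemma topspace_kspace [simp]: "topspace kspace = UNIV"
  using openin_subset[of kspace UNIV] by (auto simp: openin_kspace)

lemma openin_subtopology_kspace:
  "openin (subtopology kspace A) S \<longleftrightarrow> S \<subseteq> A \<and> (\<forall>x\<in>S. \<exists>l. agree l x \<inter> A \<subseteq> S)"
proof
  assume "openin (subtopology kspace A) S"
  then show "S \<subseteq> A \<and> (\<forall>x\<in>S. \<exists>l. agree l x \<inter> A \<subseteq> S)"
    unfolding openin_subtopology openin_kspace by (metis IntE Int_lower2 inf_mono order_refl)
next
  assume S: "S \<subseteq> A \<and> (\<forall>x\<in>S. \<exists>l. agree l x \<inter> A \<subseteq> S)"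
  let ?T = "\<Union>{agree l x | l x. agree l x \<inter> A \<subseteq> S}"
  have "openin kspace ?T"
    unfolding openin_kspace by clarify (metis (mono_tags, lifting) Sup_upper agree_eq mem_Collect_eq)
  moreover have "S = ?T \<inter> A"
    using S agree_refl by blast
  ultimately show "openin (subtopology kspace A) S"
    unfolding openin_subtopology by blast
qed

lemma dense_in_subtopology_kspace:
  "dense_in (subtopology kspace A) D \<longleftrightarrow> D \<subseteq> A \<and> (\<forall>x\<in>A. \<forall>l. agree l x \<inter> D \<noteq> {})"
proof -
  have "subtopology kspace A closure_of D = A \<longleftrightarrow> (\<forall>x\<in>A. \<forall>l. agree l x \<inter> D \<noteq> {})" if D: "D \<subseteq> A"
  proof
    assume cl: "subtopology kspace A closure_of D = A"
    show "\<forall>x\<in>A. \<forall>l. agree l x \<inter> D \<noteq> {}"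
    proof (intro ballI allI)
      fix x l assume x: "x \<in> A"
      have "openin (subtopology kspace A) (agree l x \<inter> A)"
        unfolding openin_subtopology_kspace by (auto dest: agree_eq)
      moreover have "x \<in> subtopology kspace A closure_of D"
        using cl x by simp
      ultimately have "\<exists>y. y \<in> D \<and> y \<in> agree l x \<inter> A"
        using x unfolding in_closure_of by (meson IntI agree_refl)
      then show "agree l x \<inter> D \<noteq> {}"
        by blast
    qed
  next
    assume r: "\<forall>x\<in>A. \<forall>l. agree l x \<inter> D \<noteq> {}"
    have "x \<in> subtopology kspace A closure_of D" if "x \<in> A" for x
      unfolding in_closure_of openin_subtopology_kspace
    proof (intro conjI allI impI)
      fix T assume T: "x \<in> T \<and> T \<subseteq> A \<and> (\<forall>y\<in>T. \<exists>l. agree l y \<inter> A \<subseteq> T)"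
      then obtain l where "agree l x \<inter> A \<subseteq> T"
        by blast
      moreover have "agree l x \<inter> D \<noteq> {}"
        using r that by blast
      ultimately show "\<exists>y. y \<in> D \<and> y \<in> T"
        using D by blast
    qed (use that in simp)
    then show "subtopology kspace A closure_of D = A"
      using closure_of_subset_topspace[of "subtopology kspace A" D] by auto
  qed
  then show ?thesis
    by (auto simp: dense_in_def)
qed

lemma open_balls_eq_agree:
  assumes "B \<in> open_balls X" "x \<in> B"
  obtains l where "B = agree l x \<inter> X"
proof -
  obtain s where s: "s \<in> short_seqs" "B = N s \<inter> X"
    using assms(1) by (auto simp: open_balls_def)
  obtain l where "\<And>x. x \<in> N s \<Longrightarrow> N s = agree l x"
    using N_eq_agree[OF s(1)] by blast
  then show ?thesis
    using that s(2) assms(2) by blast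
qed

section \<open>Guided runs\<close>

text \<open>The guide is written out inside the recursion because it is itself defined from the
  stage. The strict inequality makes the initial segment that determines the next guide contain
  every earlier place of disagreement. Once y has met a guide, \<open>first_diff\<close> is
  unspecified; runs are therefore followed only while alive.\<close>

function stage ::
  "('k::wellorder \<Rightarrow> ('k \<Rightarrow> 'a) set \<Rightarrow> 'k \<Rightarrow> 'a) \<Rightarrow> ('k \<Rightarrow> 'a) \<Rightarrow> 'k \<Rightarrow> 'k" where
  "stage pick y i = (LEAST l. \<forall>j<i. first_diff y (pick j (agree (stage pick y j) y)) < l)"
  by pat_completeness auto
termination
  by (relation "inv_image {(a, b). a < b} (\<lambda>(pick, y, i). i)") (auto simp: wf)

declare stage.simps [simp del]

text \<open>Only the ball around y enters, not y itself. Hence points with the same stage and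
  initial segment share their guide, and a guide is determined by an index and a ball.\<close>

definition guide ::
  "('k::wellorder \<Rightarrow> ('k \<Rightarrow> 'a) set \<Rightarrow> 'k \<Rightarrow> 'a) \<Rightarrow> ('k \<Rightarrow> 'a) \<Rightarrow> 'k \<Rightarrow> 'k \<Rightarrow> 'a" where
  "guide pick y i = pick i (agree (stage pick y i) y)"

text \<open>A failure of the \<kappa>-Baire property localized to Y: \<open>pick\<close> witnesses
  that each \<open>U j\<close> is dense in Y, and no point of Y lies in all of them. Regularity of
  \<kappa> enters as \<open>bounded\<close>.\<close>

locale guided_runs =
  fixes Y :: "('k::wellorder \<Rightarrow> 'a) set"
    and U :: "'k \<Rightarrow> ('k \<Rightarrow> 'a) set"
    and pick :: "'k \<Rightarrow> ('k \<Rightarrow> 'a) set \<Rightarrow> 'k \<Rightarrow> 'a"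
  assumes bounded: "\<And>(i::'k) h. \<exists>l::'k. \<forall>j\<le>i. h j < l"
    and pick: "\<And>j l y. y \<in> Y \<Longrightarrow> pick j (agree l y) \<in> agree l y \<inter> Y \<inter> U j"
    and U_open: "\<And>j y. y \<in> Y \<Longrightarrow> y \<in> U j \<Longrightarrow> \<exists>l. agree l y \<inter> Y \<subseteq> U j"
    and U_empty: "\<And>y. y \<in> Y \<Longrightarrow> \<exists>j. y \<notin> U j"
begin

abbreviation "G \<equiv> guide pick"
abbreviation "S \<equiv> stage pick"

text \<open>For y distinct from its guide, the tested ball is the smallest one that contains both. A
  point of Y that passes at j lies in \<open>U j\<close>.\<close>

definition passes :: "('k \<Rightarrow> 'a) \<Rightarrow> 'k \<Rightarrow> bool" where
  "passes y j \<longleftrightarrow> y \<noteq> G y j \<and> agree (first_diff y (G y j)) y \<inter> Y \<subseteq> U j"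

definition alive :: "('k \<Rightarrow> 'a) \<Rightarrow> 'k \<Rightarrow> bool" where
  "alive y i \<longleftrightarrow> (\<forall>j<i. passes y j)"

definition Q :: "('k \<Rightarrow> 'a) set" where
  "Q = {y\<in>Y. \<exists>i. alive y i \<and> y = G y i}"

section \<open>Locality: an initial segment determines the run\<close>

lemma stage_eq: "S y i = (LEAST l. \<forall>j<i. first_diff y (G y j) < l)"
  unfolding guide_def by (rule stage.simps)

lemma first_diff_less_stage: "j < i \<Longrightarrow> first_diff y (G y j) < S y i"
proof -
  have "\<exists>l. \<forall>j<i. first_diff y (G y j) < l"
    using bounded[of i "\<lambda>j. first_diff y (G y j)"] by (meson order_less_imp_le)
  then have "\<forall>j<i. first_diff y (G y j) < S y i"
    unfolding stage_eq by (rule LeastI_ex)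
  then show "j < i \<Longrightarrow> first_diff y (G y j) < S y i" by blast
qed

lemma guide_in: "y \<in> Y \<Longrightarrow> G y i \<in> agree (S y i) y \<inter> Y \<inter> U i"
  unfolding guide_def by (rule pick)

lemma stage_le_first_diff: "y \<in> Y \<Longrightarrow> y \<noteq> G y i \<Longrightarrow> S y i \<le> first_diff y (G y i)"
  using guide_in first_diff_ge by blast

lemma alive_mono: "alive y i \<Longrightarrow> j \<le> i \<Longrightarrow> alive y j"
  unfolding alive_def by auto

text \<open>All earlier disagreements of y with its guides lie below \<open>S y i\<close>. So, by
  induction, z has the same guides before i and leaves them at the same places.\<close>

lemma run_local:
  assumes "y \<in> Y" "alive y i" "z \<in> agree (S y i) y"
  shows "S z i = S y i \<and> G z i = G y i"
  using assms
proof (induction i rule: less_induct)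
  case (less i)
  have *: "G z j = G y j" "first_diff z (G z j) = first_diff y (G y j)" if "j < i" for j
  proof -
    have p: "passes y j"
      using less.prems that by (auto simp: alive_def)
    have lt: "first_diff y (G y j) < S y i"
      by (rule first_diff_less_stage[OF that])
    \<comment> \<open>Stages do not decrease along an alive run: y leaves its j-th guide at or after
      \<open>S y j\<close>, and before \<open>S y i\<close>. This puts z into the smaller stage's
      ball, as the induction hypothesis demands.\<close>
    have "S y j \<le> S y i"
      using stage_le_first_diff[of y j] p lt less.prems(1) by (auto simp: passes_def)
    then have "z \<in> agree (S y j) y"
      using less.prems(3) agree_mono by blast
    then show "G z j = G y j"
      using less.IH[OF that less.prems(1)] alive_mono[OF less.prems(2)] that by auto
    then show "first_diff z (G z j) = first_diff y (G y j)"
      using first_diff_agree(1)[OF _ lt less.prems(3)] p by (simp add: passes_def)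
  qed
  have "S z i = S y i"
    unfolding stage_eq using * by (metis (no_types, lifting))
  moreover have "agree (S y i) z = agree (S y i) y"
    using agree_eq less.prems(3) by blast
  ultimately show ?case
    by (simp add: guide_def)
qed

text \<open>Once y has left its guide before l, the ball of length l settles the outcome: the guide,
  the place of departure and the tested ball are the same for all its points.\<close>

lemma passes_local:
  assumes "y \<in> Y" "alive y i" "y \<noteq> G y i" "first_diff y (G y i) < l" "z \<in> agree l y"
  shows "z \<noteq> G z i \<and> (passes z i \<longleftrightarrow> passes y i)"
proof -
  have "S y i \<le> l"
    using stage_le_first_diff assms by (meson order.strict_implies_order order.trans)
  then have G: "G z i = G y i"
    using run_local assms agree_mono by blast
  then have d: "first_diff z (G z i) = first_diff y (G y i)" "z \<noteq> G z i"
    using first_diff_agree assms(3-5) by metis+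
  then show ?thesis
    using assms(3) agree_eq_mono[OF assms(5)] assms(4) by (auto simp: passes_def)
qed

lemma alive_local:
  assumes "y \<in> Y" "alive y i" "z \<in> agree (S y i) y"
  shows "alive z i"
  unfolding alive_def
proof (intro allI impI)
  fix j assume j: "j < i"
  then have "passes y j" "alive y j"
    using assms alive_mono by (auto simp: alive_def)
  then show "passes z j"
    using passes_local[OF assms(1) _ _ first_diff_less_stage[OF j] assms(3)] by (auto simp: passes_def)
qed

section \<open>The set of guides of alive runs\<close>

lemma guide_in_Q:
  assumes "y \<in> Y" "alive y i"
  shows "G y i \<in> Q"
proof -
  \<comment> \<open>The guide lies in the ball that determined it, so it shares the run of y up to
    i: it is alive at i and is its own i-th guide.\<close>
  have g: "G y i \<in> agree (S y i) y" "G y i \<in> Y"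
    using guide_in assms by blast+
  then show ?thesis
    using run_local[OF assms g(1)] alive_local[OF assms g(1)] unfolding Q_def by auto
qed

lemma Q_nonempty: "Y \<noteq> {} \<Longrightarrow> Q \<noteq> {}"
proof -
  assume "Y \<noteq> {}"
  then obtain y where "y \<in> Y" by blast
  \<comment> \<open>At the least index every run is vacuously alive.\<close>
  moreover have "alive y (LEAST i. True)"
    using not_less_Least by (auto simp: alive_def)
  ultimately show "Q \<noteq> {}"
    using guide_in_Q by blast
qed

text \<open>Some \<open>U j\<close> misses y, but it has a picked point in every ball around
  y.\<close>

lemma Y_not_isolated:
  assumes "y \<in> Y"
  shows "\<exists>w\<in>Y. w \<noteq> y \<and> w \<in> agree l y"
  using pick[OF assms] U_empty[OF assms] by (metis IntD1 IntD2)

text \<open>Since y is its own i-th guide and lies in \<open>U i\<close>, a point w of Y very close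
  to y has y as i-th guide and leaves it inside \<open>U i\<close>. So w survives i, and its next
  guide is a point of \<open>Q\<close> close to y that has already left y.\<close>

lemma Q_not_isolated:
  assumes "y \<in> Q"
  shows "\<exists>z\<in>Q. z \<noteq> y \<and> z \<in> agree l y"
proof -
  obtain i where y: "y \<in> Y" and i: "alive y i" "y = G y i"
    using assms by (auto simp: Q_def)
  have "y \<in> U i"
    using guide_in[OF y, of i] i(2) by simp
  then obtain m where m: "agree m y \<inter> Y \<subseteq> U i"
    using U_open y by blast
  \<comment> \<open>The three bounds make w close enough to y, let it leave y inside
    \<open>U i\<close>, and give it the same run as y up to i.\<close>
  define b where "b = max l (max m (S y i))"
  have b: "l \<le> b" "m \<le> b" "S y i \<le> b"
    unfolding b_def by (simp_all add: le_max_iff_disj)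
  obtain w where w: "w \<in> Y" "w \<noteq> y" "w \<in> agree b y"
    using Y_not_isolated[OF y] by blast
  define d where "d = first_diff w y"
  have wS: "w \<in> agree (S y i) y"
    using w(3) agree_mono b(3) by blast
  have Gw: "G w i = y"
    using run_local[OF y i(1) wS] i(2) by simp
  have d: "b \<le> d"
    unfolding d_def using w agree_eq[OF w(3)] by (intro first_diff_ge) auto
  have "agree d w \<subseteq> agree m y"
    using agree_mono[of m d w] agree_eq_mono[OF w(3) b(2)] b(2) d by auto
  then have "passes w i"
    using w(2) m Gw by (auto simp: passes_def d_def)
  then have alive: "alive w k" if "\<And>j. j < k \<Longrightarrow> j \<le> i" for k
    using that alive_local[OF y i(1) wS] by (auto simp: alive_def le_less)
  obtain k0 where "i < k0"
    using bounded[of i "\<lambda>j. j"] by blast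
  \<comment> \<open>The successor of i.\<close>
  define k where "k = (LEAST k. i < k)"
  have k: "i < k" "\<And>j. j < k \<Longrightarrow> j \<le> i"
    using LeastI[of "\<lambda>k. i < k", OF \<open>i < k0\<close>] not_less_Least[of _ "\<lambda>k. i < k"]
    by (auto simp: k_def not_less)
  define z where "z = G w k"
  have "z \<in> Q"
    unfolding z_def using guide_in_Q[OF w(1) alive[OF k(2)]] .
  have z: "z \<in> agree (S w k) w"
    unfolding z_def using guide_in[OF w(1)] by blast
  \<comment> \<open>The stage at k lies beyond d, so z copies w at the place where w differs from
    y.\<close>
  have dk: "d < S w k"
    using first_diff_less_stage[OF k(1), of w] by (simp add: Gw d_def)
  then have "z \<noteq> y"
    using first_diff_agree(2)[OF w(2) _ z] by (simp add: d_def)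
  have "l \<le> S w k"
    using b(1) d dk by simp
  then have "z \<in> agree l y"
    using z agree_mono[of l "S w k" w] agree_eq_mono[OF w(3) b(1)] by blast
  with \<open>z \<in> Q\<close> \<open>z \<noteq> y\<close> show ?thesis by blast
qed

text \<open>The point q is the guide at which the run of x stops. If a ball around x omitted q, all
  its points would stop at the same index without meeting their guide, so the ball would miss
  \<open>Q\<close>.\<close>

lemma Q_spherical:
  assumes x: "x \<in> Y"
  obtains q where "q \<in> Q" "\<And>l. agree l x \<inter> Q \<noteq> {} \<Longrightarrow> q \<in> agree l x"
proof -
  have "\<exists>i. \<not> passes x i"
  proof (rule ccontr)
    assume "\<not> ?thesis"
    then have "x \<in> U i" for i
      using x unfolding passes_def by (metis IntI agree_refl subsetD)
    then show False
      using U_empty[OF x] by blast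
  qed
  then have "\<exists>i. \<not> passes x i \<and> (\<forall>j<i. passes x j)"
    by (subst (asm) exists_least_iff) simp
  then obtain i where i: "\<not> passes x i" "alive x i"
    by (auto simp: alive_def)
  let ?q = "G x i"
  have "?q \<in> agree l x" if l: "agree l x \<inter> Q \<noteq> {}" for l
  \<comment> \<open>In the first case q agrees with x below l already.\<close>
  proof (cases "x = ?q \<or> l \<le> first_diff x ?q")
    case True
    then show ?thesis
      using agree_mono[of l "first_diff x ?q" x] agree_first_diff[of ?q x] by auto
  next
    case False
    then have ne: "x \<noteq> ?q" and less: "first_diff x ?q < l"
      by auto
    obtain z where z: "z \<in> agree l x" "z \<in> Q"
      using l by blast
    then obtain i' where i': "alive z i'" "z = G z i'"
      by (auto simp: Q_def)
    have nz: "z \<noteq> G z i" "\<not> passes z i"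
      using passes_local[OF x i(2) ne less z(1)] i(1) by auto
    have "S x i \<le> l"
      using stage_le_first_diff[OF x ne] less by simp
    then have "alive z i"
      using alive_local[OF x i(2)] z(1) agree_mono by blast
    \<comment> \<open>The index i' cannot be below i, since z passes there and so differs from that
      guide; it cannot be i, since z differs from \<open>G z i\<close>; and it cannot exceed i,
      since z does not pass at i.\<close>
    then show ?thesis
      using i' nz unfolding alive_def passes_def by (metis linorder_neqE)
  qed
  then show ?thesis
    using that guide_in_Q[OF x i(2)] by blast
qed

lemma Q_subset_picks: "Q \<subseteq> (\<lambda>(i, B). pick i B) ` (UNIV \<times> range (\<lambda>(l, x). agree l x))"
proof
  fix y assume "y \<in> Q"
  then obtain i where "y = pick i (agree (S y i) y)"
    by (auto simp: Q_def guide_def)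
  moreover have "(i, agree (S y i) y) \<in> UNIV \<times> range (\<lambda>(l, x). agree l x)"
    by auto
  ultimately show "y \<in> (\<lambda>(i, B). pick i B) ` (UNIV \<times> range (\<lambda>(l, x). agree l x))"
    by (metis (no_types, lifting) case_prod_conv imageI)
qed

end

section \<open>The equivalence\<close>

lemma Field_kappa [simp]: "Field kappa = UNIV"
  by (auto simp: kappa_def Field_def)

lemma small_bounded:
  fixes h :: "'i \<Rightarrow> 'k::wellorder"
  assumes reg: "regularCard (kappa :: 'k rel)"
    and small: "|I| <o (kappa :: 'k rel)"
  shows "\<exists>l. \<forall>i\<in>I. h i \<le> l"
proof (rule ccontr)
  assume "\<not> ?thesis"
  \<comment> \<open>Cofinality asks for strictly larger elements, which is what the negated weak
    bound supplies.\<close>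
  then have "cofinal (h ` I) (kappa :: 'k rel)"
    by (force simp: cofinal_def kappa_def not_le)
  then have "|h ` I| =o (kappa :: 'k rel)"
    using reg by (auto simp: regularCard_def)
  then show False
    using small card_of_image[of h I] not_ordLess_ordLeq ordIso_ordLeq_trans ordIso_symmetric
    by blast
qed

lemma infinite_kappa:
  assumes "card_order (kappa :: 'k::wellorder rel)" "natLeq <o (kappa :: 'k rel)"
  shows "infinite (UNIV :: 'k set)"
proof -
  have "cinfinite (kappa :: 'k rel)"
    using assms natLeq_ordLeq_cinfinite cinfinite_mono natLeq_cinfinite ordLess_imp_ordLeq by blast
  then show ?thesis by (simp add: cinfinite_def)
qed

lemma kappa_no_max:
  fixes l :: "'k::wellorder"
  assumes "card_order (kappa :: 'k rel)" "natLeq <o (kappa :: 'k rel)"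
  shows "\<exists>m. l < m"
proof -
  have "Card_order (kappa :: 'k rel)"
    using assms(1) by simp
  then obtain m where "l \<noteq> m" "(l, m) \<in> kappa"
    using infinite_Card_order_limit[of kappa l] infinite_kappa[OF assms] by auto
  then show ?thesis
    by (auto simp: kappa_def intro: le_neq_trans)
qed

lemma kappa_strict_bounded:
  fixes h :: "'i \<Rightarrow> 'k::wellorder"
  assumes card: "card_order (kappa :: 'k rel)" and inf: "natLeq <o (kappa :: 'k rel)"
    and reg: "regularCard (kappa :: 'k rel)"
    and small: "|I| <o (kappa :: 'k rel)"
  shows "\<exists>l. \<forall>i\<in>I. h i < l"
proof -
  obtain l where l: "\<forall>i\<in>I. h i \<le> l"
    using small_bounded[OF reg small] by blast
  obtain m where "l < m"
    using kappa_no_max[OF card inf] by blast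
  with l show ?thesis
    by (meson order_le_less_trans)
qed

lemma small_atMost:
  fixes i :: "'k::wellorder"
  assumes card: "card_order (kappa :: 'k rel)" and inf: "natLeq <o (kappa :: 'k rel)"
  shows "|{..i}| <o (kappa :: 'k rel)"
proof -
  obtain m where "i < m"
    using kappa_no_max[OF card inf] by blast
  then have "{..i} \<subseteq> underS kappa m"
    by (auto simp: underS_def kappa_def)
  then show ?thesis
    using card_of_mono1[of "{..i}"] card_of_underS[of kappa m] card
    by (auto intro: ordLeq_ordLess_trans)
qed

text \<open>Fewer than \<kappa> open sets containing x contain balls around x whose lengths have a
  common bound, so one ball around x lies in their intersection.\<close>

lemma kappa_isolated_iff:
  fixes Q :: "('k::wellorder \<Rightarrow> 'k) set"
  assumes card: "card_order (kappa :: 'k rel)" and inf: "natLeq <o (kappa :: 'k rel)"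
    and reg: "regularCard (kappa :: 'k rel)"
    and x: "x \<in> Q"
  shows "kappa_isolated (kappa :: 'k rel) (subtopology kspace Q) x \<longleftrightarrow> (\<exists>l. agree l x \<inter> Q = {x})"
proof
  assume "kappa_isolated (kappa :: 'k rel) (subtopology kspace Q) x"
  then obtain \<U> where U: "|\<U>| <o (kappa :: 'k rel)" "\<forall>U\<in>\<U>. openin (subtopology kspace Q) U"
    and eq: "Q \<inter> \<Inter>\<U> = {x}"
    by (auto simp: kappa_isolated_def)
  have "\<forall>U\<in>\<U>. \<exists>l. agree l x \<inter> Q \<subseteq> U"
    using U(2) eq unfolding openin_subtopology_kspace by blast
  then obtain h where h: "\<forall>U\<in>\<U>. agree (h U) x \<inter> Q \<subseteq> U"
    by metis
  obtain l where l: "\<forall>U\<in>\<U>. h U \<le> l"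
    using small_bounded[OF reg U(1)] by blast
  have "agree l x \<inter> Q \<subseteq> U" if "U \<in> \<U>" for U
    using that h l agree_mono by blast
  then have "agree l x \<inter> Q = {x}"
    using eq x agree_refl[of x l] by blast
  then show "\<exists>l. agree l x \<inter> Q = {x}" ..
next
  assume "\<exists>l. agree l x \<inter> Q = {x}"
  then have "openin (subtopology kspace Q) {x}"
    using x by (auto simp: openin_subtopology_kspace)
  moreover have "|{{x}}| <o (kappa :: 'k rel)"
    using card infinite_kappa[OF card inf]
    by (intro finite_ordLess_infinite card_of_Well_order) (auto simp: card_order_on_well_order_on Field_card_of)
  ultimately show "kappa_isolated (kappa :: 'k rel) (subtopology kspace Q) x"
    unfolding kappa_isolated_def using x by (intro exI[of _ "{{x}}"]) auto
qed

section \<open>Baire property and cardinality\<close>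

lemma not_Baire_if_no_isolated:
  fixes Q :: "('k::wellorder \<Rightarrow> 'k) set"
  assumes card: "|Q| =o (kappa :: 'k rel)"
    and cr: "\<And>x l. x \<in> Q \<Longrightarrow> agree l x \<inter> Q \<noteq> {x}"
    and ord: "card_order (kappa :: 'k rel)" and inf: "natLeq <o (kappa :: 'k rel)"
  shows "\<not> Baire_space (kappa :: 'k rel) (subtopology kspace Q)"
proof
  assume B: "Baire_space (kappa :: 'k rel) (subtopology kspace Q)"
  have "|Q| =o |UNIV :: 'k set|"
    using card ord card_of_unique ordIso_transitive by blast
  \<comment> \<open>An enumeration along \<kappa>, as the dense open sets must be indexed by
    \<kappa>; it also shows that \<open>Q\<close> is nonempty, so the empty set is not
    dense.\<close>
  then obtain g :: "'k \<Rightarrow> ('k \<Rightarrow> 'k)" where g: "bij_betw g UNIV Q"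
    using card_of_ordIso ordIso_symmetric by blast
  have rg: "range g = Q"
    using g by (simp add: bij_betw_def)
  have "openin (subtopology kspace Q) (Q - {q})" for q
    unfolding openin_subtopology_kspace
  proof (intro conjI ballI)
    fix x assume "x \<in> Q - {q}"
    then have "x \<noteq> q" by auto
    then obtain a where "x a \<noteq> q a" by auto
    moreover obtain b where "a < b"
      using kappa_no_max[OF ord inf] by blast
    ultimately have "q \<notin> agree b x"
      by (auto simp: agree_def)
    then show "\<exists>l. agree l x \<inter> Q \<subseteq> Q - {q}" by blast
  qed auto
  moreover have "dense_in (subtopology kspace Q) (Q - {q})" for q
    unfolding dense_in_subtopology_kspace
  proof (intro conjI ballI allI)
    fix x l assume x: "x \<in> Q"
    have "x \<in> agree l x \<inter> Q"
      using x by simp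
    then show "agree l x \<inter> (Q - {q}) \<noteq> {}"
      using cr[OF x, of l] by blast
  qed auto
  ultimately have "dense_in (subtopology kspace Q) (Q \<inter> (\<Inter>i. Q - {g i}))"
    using B[unfolded Baire_space_def, rule_format, of "\<lambda>i. Q - {g i}"] by simp
  moreover have "Q \<inter> (\<Inter>i. Q - {g i}) = {}"
    using rg by auto
  ultimately show False
    using rg by (auto simp: dense_in_subtopology_kspace)
qed

text \<open>The places where points of Q split from y are unbounded in \<kappa>, so by regularity
  there are \<kappa> many of them.\<close>

lemma kappa_le_card_if_no_isolated:
  fixes Q :: "('k::wellorder \<Rightarrow> 'k) set"
  assumes ord: "card_order (kappa :: 'k rel)" and inf: "natLeq <o (kappa :: 'k rel)"
    and reg: "regularCard (kappa :: 'k rel)"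
    and y: "y \<in> Q" and limit: "\<And>l. agree l y \<inter> Q \<noteq> {y}"
  shows "(kappa :: 'k rel) \<le>o |Q|"
proof -
  let ?D = "first_diff y ` (Q - {y})"
  have "\<exists>d\<in>?D. a < d" for a
  proof -
    obtain b where b: "a < b"
      using kappa_no_max[OF ord inf] by blast
    obtain z where z: "z \<in> Q" "z \<noteq> y" "z \<in> agree b y"
      using limit[of b] y agree_refl[of y b] by blast
    then have "a < first_diff y z"
      using first_diff_ge[of y z b] b by auto
    then show ?thesis
      using z by blast
  qed
  then have "cofinal ?D (kappa :: 'k rel)"
    by (force simp: cofinal_def kappa_def)
  then have "|?D| =o (kappa :: 'k rel)"
    using reg by (auto simp: regularCard_def)
  moreover have "|?D| \<le>o |Q|"
    using card_of_image card_of_mono1[of "Q - {y}" Q] ordLeq_transitive by blast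
  ultimately show ?thesis
    using ordIso_ordLeq_trans ordIso_symmetric by blast
qed

text \<open>Here \<kappa>^{<\<kappa>} = \<kappa> enters, expressed as the number of short
  sequences.\<close>

lemma card_agree_sets:
  assumes "|short_seqs :: ('k::wellorder \<rightharpoonup> 'k) set| =o (kappa :: 'k rel)"
  shows "|range (\<lambda>(l :: 'k, x :: 'k \<Rightarrow> 'k). agree l x)| \<le>o (kappa :: 'k rel)"
proof -
  have "range (\<lambda>(l :: 'k, x :: 'k \<Rightarrow> 'k). agree l x) \<subseteq> N ` short_seqs"
    using agree_in_N by fastforce
  then show ?thesis
    using assms card_of_mono1 card_of_image ordLeq_transitive ordLeq_ordIso_trans by meson
qed

lemma (in guided_runs) card_Q_le:
  assumes "card_order (kappa :: 'k rel)" "infinite (UNIV :: 'k set)"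
    and balls: "|range (\<lambda>(l :: 'k, x :: 'k \<Rightarrow> 'a). agree l x)| \<le>o (kappa :: 'k rel)"
  shows "|Q| \<le>o (kappa :: 'k rel)"
proof -
  have "|UNIV :: 'k set| \<le>o (kappa :: 'k rel)"
    using assms(1) card_of_unique ordIso_symmetric ordIso_imp_ordLeq by blast
  then have "|(UNIV :: 'k set) \<times> range (\<lambda>(l :: 'k, x :: 'k \<Rightarrow> 'a). agree l x)| \<le>o (kappa :: 'k rel)"
    using balls assms(1,2) by (intro card_of_Times_ordLeq_infinite_Field) auto
  then show ?thesis
    by (rule ordLeq_transitive[OF card_of_mono1[OF Q_subset_picks] ordLeq_transitive[OF card_of_image]])
qed

section \<open>Spherically closed subsets\<close>

lemma spherically_closed_Int_agree:
  assumes A: "spherically_closed X A"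
  shows "spherically_closed X (A \<inter> agree l y)"
  unfolding spherically_closed_def
proof (intro conjI allI impI)
  show "A \<inter> agree l y \<subseteq> X"
    using A by (auto simp: spherically_closed_def)
  fix r :: "'a rel" and B
  assume r: "Well_order r" "Field r \<noteq> {}"
    and B: "\<forall>i\<in>Field r. B i \<in> open_balls X \<and> B i \<inter> (A \<inter> agree l y) \<noteq> {}"
    and dec: "\<forall>i j. (i, j) \<in> r \<longrightarrow> B j \<subseteq> B i" and ne: "(\<Inter>i\<in>Field r. B i) \<noteq> {}"
  have "\<forall>i\<in>Field r. B i \<in> open_balls X \<and> B i \<inter> A \<noteq> {}"
    using B by blast
  then have "(\<Inter>i\<in>Field r. B i) \<inter> A \<noteq> {}"
    using A r dec ne unfolding spherically_closed_def by blast
  then obtain x where x: "x \<in> A" "\<And>i. i \<in> Field r \<Longrightarrow> x \<in> B i"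
    by blast
  show "(\<Inter>i\<in>Field r. B i) \<inter> (A \<inter> agree l y) \<noteq> {}"
  proof (cases "x \<in> agree l y")
    case True
    then show ?thesis using x by blast
  next
    case False
    \<comment> \<open>Balls that meet are nested. As x lies in \<open>B i\<close> but outside
      \<open>agree l y\<close>, the ball \<open>B i\<close> is the larger one within X.\<close>
    have sub: "A \<inter> agree l y \<subseteq> B i" if i: "i \<in> Field r" for i
    proof -
      obtain b where b: "B i = agree b x \<inter> X"
        using open_balls_eq_agree B x(2) i by metis
      obtain z where z: "z \<in> agree b x" "z \<in> agree l y"
        using B i b by blast
      have "b \<le> l"
        using False z agree_eq_mono[OF z(1), of l] agree_eq[OF z(2)] agree_refl[of x l] by force
      then have "agree l y \<subseteq> agree b x"
        using agree_eq_mono[OF z(2)] agree_eq[OF z(1)] agree_mono by blast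
      then show ?thesis
        using b A by (auto simp: spherically_closed_def)
    qed
    obtain i0 where "i0 \<in> Field r"
      using r(2) by blast
    then obtain z where "z \<in> A \<inter> agree l y"
      using B by blast
    then show ?thesis
      using sub by blast
  qed
qed

text \<open>The closedness of Y yields a common point x of the balls. All of them are then balls
  around x that meet Q, so the point q belonging to x lies in each.\<close>

lemma spherically_closed_subset:
  assumes Y: "spherically_closed X Y" and "Q \<subseteq> Y"
    and Q: "\<And>x. x \<in> Y \<Longrightarrow> \<exists>q\<in>Q. \<forall>l. agree l x \<inter> Q \<noteq> {} \<longrightarrow> q \<in> agree l x"
  shows "spherically_closed X Q"
  unfolding spherically_closed_def
proof (intro conjI allI impI)
  show QX: "Q \<subseteq> X"
    using Y \<open>Q \<subseteq> Y\<close> by (auto simp: spherically_closed_def)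
  fix r :: "'a rel" and B
  assume r: "Well_order r" "Field r \<noteq> {}"
    and B: "\<forall>i\<in>Field r. B i \<in> open_balls X \<and> B i \<inter> Q \<noteq> {}"
    and dec: "\<forall>i j. (i, j) \<in> r \<longrightarrow> B j \<subseteq> B i" and ne: "(\<Inter>i\<in>Field r. B i) \<noteq> {}"
  have "\<forall>i\<in>Field r. B i \<in> open_balls X \<and> B i \<inter> Y \<noteq> {}"
    using B \<open>Q \<subseteq> Y\<close> by blast
  then have "(\<Inter>i\<in>Field r. B i) \<inter> Y \<noteq> {}"
    using Y r dec ne unfolding spherically_closed_def by blast
  then obtain x where x: "x \<in> Y" "\<And>i. i \<in> Field r \<Longrightarrow> x \<in> B i"
    by blast
  obtain q where q: "q \<in> Q" "\<forall>l. agree l x \<inter> Q \<noteq> {} \<longrightarrow> q \<in> agree l x"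
    using Q x(1) by blast
  have "q \<in> B i" if i: "i \<in> Field r" for i
  proof -
    obtain b where b: "B i = agree b x \<inter> X"
      using open_balls_eq_agree B x(2) i by metis
    then have "agree b x \<inter> Q \<noteq> {}"
      using B i by blast
    then show ?thesis
      using q b QX by blast
  qed
  then show "(\<Inter>i\<in>Field r. B i) \<inter> Q \<noteq> {}"
    using q(1) by blast
qed

theorem theorem6p2:
  fixes X :: "('k::wellorder \<Rightarrow> 'k) set"
  assumes "card_order (kappa :: 'k rel)"
    and "natLeq <o (kappa :: 'k rel)"
    and "regularCard (kappa :: 'k rel)"
    and "|short_seqs :: ('k \<rightharpoonup> 'k) set| =o (kappa :: 'k rel)"
  shows "\<not> hereditarily_Baire X \<longleftrightarrow>
    (\<exists>Q\<subseteq>X. spherically_closed X Q \<and> |Q| =o (kappa :: 'k rel) \<and>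
       (\<forall>x\<in>Q. \<not> kappa_isolated (kappa :: 'k rel) (subtopology kspace Q) x))"
proof
  assume "\<not> hereditarily_Baire X"
  then obtain A where A: "spherically_closed X A"
    and nB: "\<not> Baire_space (kappa :: 'k rel) (subtopology kspace A)"
    by (auto simp: hereditarily_Baire_def)
  then obtain U :: "'k \<Rightarrow> ('k \<Rightarrow> 'k) set"
    where open_U: "\<And>i. openin (subtopology kspace A) (U i)"
      and dense_U: "\<And>i. dense_in (subtopology kspace A) (U i)"
      and not_dense: "\<not> dense_in (subtopology kspace A) (A \<inter> (\<Inter>i. U i))"
    unfolding Baire_space_def by auto
  \<comment> \<open>Failure of density gives a ball around a point of A that misses the
    intersection; cutting A down to this ball makes the intersection empty.\<close>
  obtain y l where y: "y \<in> A" and empty: "agree l y \<inter> (A \<inter> (\<Inter>i. U i)) = {}"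
    using not_dense unfolding dense_in_subtopology_kspace by blast
  define Y where "Y = A \<inter> agree l y"
  define pick where "pick j B = (SOME q. q \<in> B \<inter> Y \<inter> U j)" for j B
  interpret guided_runs Y U pick
  proof
    fix i and h :: "'k \<Rightarrow> 'k"
    show "\<exists>l. \<forall>j\<le>i. h j < l"
      using kappa_strict_bounded[OF assms(1-3) small_atMost[OF assms(1,2)], of i h] by auto
  next
    fix j m z assume "z \<in> Y"
    then have z: "z \<in> A" "agree l z = agree l y"
      using agree_eq[of z l y] by (auto simp: Y_def)
    \<comment> \<open>The longer of the two lengths keeps the point given by density both in Y and
      in the prescribed ball.\<close>
    obtain q where q: "q \<in> agree (max l m) z" "q \<in> U j"
      using dense_U[of j] z(1) unfolding dense_in_subtopology_kspace by blast
    moreover have "q \<in> A"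
      using q(2) dense_U[of j] unfolding dense_in_subtopology_kspace by blast
    moreover have "agree (max l m) z \<subseteq> agree l y" "agree (max l m) z \<subseteq> agree m z"
      using z(2) agree_mono[of l "max l m" z] agree_mono[of m "max l m" z] by auto
    ultimately have "q \<in> agree m z \<inter> Y \<inter> U j"
      by (auto simp: Y_def)
    then show "pick j (agree m z) \<in> agree m z \<inter> Y \<inter> U j"
      unfolding pick_def by (rule someI[of "\<lambda>q. q \<in> agree m z \<inter> Y \<inter> U j"])
  next
    fix j z assume "z \<in> Y" "z \<in> U j"
    then obtain m where "agree m z \<inter> A \<subseteq> U j"
      using open_U[of j] unfolding openin_subtopology_kspace by blast
    then have "agree m z \<inter> Y \<subseteq> U j"
      by (auto simp: Y_def)
    then show "\<exists>m. agree m z \<inter> Y \<subseteq> U j" ..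
  next
    fix z assume "z \<in> Y"
    then show "\<exists>j. z \<notin> U j"
      using empty unfolding Y_def by blast
  qed
  have "Q \<subseteq> Y"
    by (auto simp: Q_def)
  have closed: "spherically_closed X Q"
  proof (rule spherically_closed_subset)
    show "spherically_closed X Y"
      unfolding Y_def by (rule spherically_closed_Int_agree[OF A])
    show "\<exists>q\<in>Q. \<forall>l. agree l x \<inter> Q \<noteq> {} \<longrightarrow> q \<in> agree l x" if "x \<in> Y" for x
      using Q_spherical[OF that] by metis
  qed fact
  have limit: "agree l x \<inter> Q \<noteq> {x}" if "x \<in> Q" for x l
    using Q_not_isolated[OF that, of l] by blast
  have "Y \<noteq> {}"
    using y by (auto simp: Y_def intro: agree_refl)
  then obtain x where "x \<in> Q"
    using Q_nonempty by blast
  \<comment> \<open>The lower bound comes from the absence of isolated points, the upper bound from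
    counting pairs of an index and a ball.\<close>
  then have "|Q| =o (kappa :: 'k rel)"
    using kappa_le_card_if_no_isolated[OF assms(1-3) _ limit]
      card_Q_le[OF assms(1) infinite_kappa[OF assms(1,2)] card_agree_sets[OF assms(4)]]
    by (simp add: ordIso_iff_ordLeq)
  then show "\<exists>Q\<subseteq>X. spherically_closed X Q \<and> |Q| =o (kappa :: 'k rel) \<and>
       (\<forall>x\<in>Q. \<not> kappa_isolated (kappa :: 'k rel) (subtopology kspace Q) x)"
    using closed limit kappa_isolated_iff[OF assms(1-3), of _ Q]
    by (intro exI[of _ Q] conjI) (auto simp: spherically_closed_def[of X Q])
next
  assume "\<exists>Q\<subseteq>X. spherically_closed X Q \<and> |Q| =o (kappa :: 'k rel) \<and>
       (\<forall>x\<in>Q. \<not> kappa_isolated (kappa :: 'k rel) (subtopology kspace Q) x)"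
  then obtain Q where "spherically_closed X Q" "|Q| =o (kappa :: 'k rel)"
    and "\<And>x. x \<in> Q \<Longrightarrow> \<not> kappa_isolated (kappa :: 'k rel) (subtopology kspace Q) x"
    by blast
  moreover from this have "\<not> Baire_space (kappa :: 'k rel) (subtopology kspace Q)"
    using kappa_isolated_iff[OF assms(1-3), of _ Q]
    by (intro not_Baire_if_no_isolated[OF _ _ assms(1,2)]) auto
  ultimately show "\<not> hereditarily_Baire X"
    unfolding hereditarily_Baire_def by blast
qed

end
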